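(* Let $\lambda>0$ and let $\mu_\lambda$ be a standard probability measure on $\mathbb{R}$ having a generating function of ultraspherical type with parameter $\lambda$ on a region $S$ with functions $u_\lambda,f_\lambda$, and satisfying the interchange condition on $S$ (all these notions are defined in the context). Let $Q_1(z)=(\lambda+1)\omega_2^\lambda z+\alpha_1^\lambda$, where $\alpha_1^\lambda,\omega_2^\lambda$ are Jacobi-Szegő parameters of $\mu_\lambda$, and suppose that there is a polynomial $E_\lambda$ such that $$f_\lambda(z)-\frac{Q_1(z)}{2}=\frac{E_\lambda(z)}{z},\qquad z\in S.$$ Then $\deg(E_\lambda)\le2$.
   Context: Standard measure: $\mu_\lambda$ is a probability measure on $\mathbb{R}$ with finite moments of all orders, mean $0$ and variance $1$. Its monic orthogonal polynomials $(P_n^\lambda)_{n\ge0}$ (with $\deg P_n^\lambda=n$, $\int P_n^\lambda P_m^\lambda\,d\mu_\lambda=0$ for $n\ne m$) satisfy $xP_n^\lambda(x)=P_{n+1}^\lambda(x)+\alpha_n^\lambda P_n^\lambda(x)+\omega_n^\lambda P_{n-1}^\lambda(x)$ for $n\ge0$, with $P_{-1}^\lambda:=0$, $P_0^\lambda=1$; the reals $\alpha_n^\lambda$, $\omega_n^\lambda\ge0$ are the Jacobi-Szegő parameters. Standardness means $\alpha_0^\lambda=0$, $\omega_1^\lambda=1$. Notation: $(\lambda)_n=\lambda(\lambda+1)\cdots(\lambda+n-1)$, $(\lambda)_0=1$. Complex powers $w^\lambda$ use the principal logarithm. Generating function of ultraspherical type with parameter $\lambda>0$: there are a nonempty connected open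 set (region) $S\subset\mathbb{C}\setminus(-\infty,0]$ with $0$ in its closure, and analytic functions $u_\lambda,f_\lambda$ on $S$, with $u_\lambda$ nowhere zero, such that $\Im f_\lambda(z)\neq0$ for $z\in S$, $\lim_{z\to0,z\in S}zf_\lambda(z)=1$, $\lim_{z\to0,z\in S}u_\lambda(z)/z^\lambda=1$, and for all $x\in\mathrm{supp}(\mu_\lambda)$ and $z\in S$ the series below converges and $$\psi_\lambda(z,x):=\sum_{n\ge0}\frac{(\lambda)_n}{n!}P_n^\lambda(x)z^n=\frac{1}{u_\lambda(z)(f_\lambda(z)-x)^\lambda}.$$ Interchange condition on $S$: for $i\in\{0,1,2\}$ and all $z\in S$, $$\int\sum_{n\ge0}\frac{(\lambda)_n}{n!}x^iP_n^\lambda(x)z^n\,\mu_\lambda(dx)=\sum_{n\ge0}\frac{(\lambda)_n}{n!}\left(\int x^iP_n^\lambda(x)\,\mu_\lambda(dx)\right)z^n.$$ *)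

theory Defs
  imports "HOL-Probability.Probability" "HOL-Computational_Algebra.Polynomial"
begin

definition standard_measure :: "real measure \<Rightarrow> bool" where
  "standard_measure M \<longleftrightarrow>
     real_distribution M \<and>
     (\<forall>n::nat. integrable M (\<lambda>x. x ^ n)) \<and>
     prob_space.expectation M (\<lambda>x. x) = 0 \<and>
     prob_space.variance M (\<lambda>x. x) = 1"

definition measure_supp :: "real measure \<Rightarrow> real set" where
  "measure_supp M = {x. \<forall>U. open U \<longrightarrow> x \<in> U \<longrightarrow> emeasure M U > 0}"

(* A relation rather than functions of M: if M is supported on exactly N points, then
   P n for n > N, and the corresponding parameters, are not determined by M.
   There is no \<omega> 0, because its coefficient in the recurrence is P_{-1} = 0. *)
definition jacobi_szego ::
  "real measure \<Rightarrow> (nat \<Rightarrow> real poly) \<Rightarrow> (nat \<Rightarrow> real) \<Rightarrow> (nat \<Rightarrow> real) \<Rightarrow> bool" where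
  "jacobi_szego M P \<alpha> \<omega> \<longleftrightarrow>
     (\<forall>n. degree (P n) = n \<and> lead_coeff (P n) = 1) \<and>
     (\<forall>m n. m \<noteq> n \<longrightarrow> (\<integral>x. poly (P n) x * poly (P m) x \<partial>M) = 0) \<and>
     (\<forall>n. [:0, 1:] * P n = P (n + 1) + smult (\<alpha> n) (P n) +
            (if n = 0 then 0 else smult (\<omega> n) (P (n - 1)))) \<and>
     (\<forall>n\<ge>1. \<omega> n \<ge> 0)"

definition ultraspherical_gf ::
  "real \<Rightarrow> real measure \<Rightarrow> (nat \<Rightarrow> real poly) \<Rightarrow> complex set \<Rightarrow>
   (complex \<Rightarrow> complex) \<Rightarrow> (complex \<Rightarrow> complex) \<Rightarrow> bool" where
  "ultraspherical_gf l M P S u f \<longleftrightarrow>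
     open S \<and> connected S \<and> S \<noteq> {} \<and> S \<inter> \<real>\<^sub>\<le>\<^sub>0 = {} \<and> 0 \<in> closure S \<and>
     u analytic_on S \<and> f analytic_on S \<and>
     (\<forall>z\<in>S. u z \<noteq> 0) \<and> (\<forall>z\<in>S. Im (f z) \<noteq> 0) \<and>
     ((\<lambda>z. z * f z) \<longlongrightarrow> 1) (at 0 within S) \<and>
     ((\<lambda>z. u z / z powr of_real l) \<longlongrightarrow> 1) (at 0 within S) \<and>
     (\<forall>x\<in>measure_supp M. \<forall>z\<in>S.
        (\<lambda>n. of_real (pochhammer l n / fact n * poly (P n) x) * z ^ n) sums
          (1 / (u z * (f z - of_real x) powr of_real l)))"

(* Integrability of the left-hand integrand and convergence of the right-hand series are
   implicit in the interchange identity; they must be explicit here because the Bochner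
   integral and suminf are total. *)
definition interchange_condition ::
  "real \<Rightarrow> real measure \<Rightarrow> (nat \<Rightarrow> real poly) \<Rightarrow> complex set \<Rightarrow> bool" where
  "interchange_condition l M P S \<longleftrightarrow>
     (\<forall>i\<in>{0, 1, 2::nat}. \<forall>z\<in>S.
        integrable M (\<lambda>x. \<Sum>n. of_real (pochhammer l n / fact n * x ^ i * poly (P n) x) * z ^ n) \<and>
        (\<lambda>n. of_real (pochhammer l n / fact n * (\<integral>x. x ^ i * poly (P n) x \<partial>M)) * z ^ n) sums
          (\<integral>x. (\<Sum>n. of_real (pochhammer l n / fact n * x ^ i * poly (P n) x) * z ^ n) \<partial>M))"

end

(* Integrating x^i psi(z, x) termwise for i = 0, 1, 2 shows that the functions
   G_i(w) = \<integral> x^i (w - x)^(-l) d\<mu> satisfy G_i(f z) = q_i(z) u(z) with q_0 = 1, q_1 = l z and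
   q_2 = 1 + l \<alpha>_1 z + l (l + 1) \<omega>_2 z^2 / 2.  Writing A_i for the analogous integrals with
   exponent - l - 1, one has G_i' = - l A_i and G_i = w A_i - A_(i+1); differentiating along f
   and eliminating A_0, A_1, A_2 and u'/u gives the Riccati equation
     f' (q_2 - l^2 z^2) = q_2 + Q_1 f - l z Q_1 - f^2   on S.
   Substituting f = Q_1/2 + E/z and multiplying by z^2 gives a polynomial identity in which
   E^2 is the only term of degree greater than max 4 (deg E + 2) if deg E > 2. *)

theory Submission
  imports Defs
begin

section \<open>The support carries full measure\<close>

text \<open>By second countability, the complement of the support is covered by countably many null
  basic open sets. The closed form of the generating function is only given on the support; this
  makes it an almost everywhere identity, which is enough under the integral.\<close>

lemma AE_measure_supp:
  assumes "sets M = sets borel"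
  shows "AE x in M. x \<in> measure_supp M"
proof -
  obtain B :: "real set set" where B: "countable B" "topological_basis B"
    using ex_countable_basis by blast
  have open_B: "open U" if "U \<in> B" for U
    using B(2) that by (rule topological_basis_open)
  have "(\<Union>{U \<in> B. emeasure M U = 0}) \<in> null_sets M"
  proof -
    have "(\<Union>U\<in>{U \<in> B. emeasure M U = 0}. U) \<in> null_sets M"
      using B(1) open_B assms by (intro null_sets_UN') (auto simp: null_sets_def)
    then show ?thesis by simp
  qed
  moreover have "- measure_supp M \<subseteq> \<Union>{U \<in> B. emeasure M U = 0}"
  proof
    fix x assume "x \<in> - measure_supp M"
    then obtain V where V: "open V" "x \<in> V" "emeasure M V = 0"
      unfolding measure_supp_def by (auto simp: zero_less_iff_neq_zero)
    obtain U where U: "U \<in> B" "x \<in> U" "U \<subseteq> V"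
      using topological_basisE[OF B(2) V(1,2)] by blast
    have "emeasure M U \<le> emeasure M V"
      using U(3) V(1) assms by (intro emeasure_mono) auto
    with U V(3) show "x \<in> \<Union>{U \<in> B. emeasure M U = 0}" by auto
  qed
  ultimately show ?thesis
    by (intro AE_I'[of "\<Union>{U \<in> B. emeasure M U = 0}"]) auto
qed

section \<open>Integrals of the kernels x^i (w - x)^(-l)\<close>

text \<open>For w off the real axis, w - x never meets the branch cut of the principal
  logarithm.\<close>

lemma has_field_derivative_powr_kernel:
  fixes w :: complex
  assumes "Im w \<noteq> 0"
  shows "((\<lambda>w. of_real (x ^ i) * (w - of_real x) powr of_real (- l)) has_field_derivative
           of_real (- l) * (of_real (x ^ i) * (w - of_real x) powr of_real (- l - 1))) (at w)"
proof -
  have "w - of_real x \<notin> \<real>\<^sub>\<le>\<^sub>0"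
    using assms by (auto simp: complex_nonpos_Reals_iff)
  then show ?thesis
    by (auto intro!: derivative_eq_intros)
qed

text \<open>For real x, |w - x| is at least |Im w|, and a nonpositive real exponent reverses the
  inequality. The bound is uniform in all w with |Im w| at least \<open>c\<close>, so it can
  dominate the kernel on a whole neighbourhood.\<close>

lemma norm_powr_kernel_le:
  fixes w :: complex
  assumes "0 < c" "c \<le> \<bar>Im w\<bar>" "0 \<le> l"
  shows "norm (of_real (x ^ i) * (w - of_real x) powr of_real (- l)) \<le> \<bar>x\<bar> ^ i * c powr (- l)"
proof -
  have "c \<le> norm (w - of_real x)"
    using abs_Im_le_cmod[of "w - of_real x"] assms(2) by simp
  then have "norm (w - of_real x) powr (- l) \<le> c powr (- l)"
    using assms by (intro powr_mono2') auto
  moreover have "norm ((w - of_real x) powr of_real (- l)) = norm (w - of_real x) powr (- l)"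
    using norm_powr_real_powr'[of "of_real (- l)" "w - of_real x"] by simp
  ultimately show ?thesis
    by (auto simp: norm_mult norm_power intro!: mult_left_mono)
qed

lemma borel_measurable_powr_kernel:
  fixes w :: complex
  assumes "Im w \<noteq> 0"
  shows "(\<lambda>x. of_real (x ^ i) * (w - complex_of_real x) powr of_real l) \<in> borel_measurable borel"
proof (rule borel_measurable_continuous_onI)
  have "w - of_real x \<notin> \<real>\<^sub>\<le>\<^sub>0" for x
    using assms by (auto simp: complex_nonpos_Reals_iff)
  then show "continuous_on UNIV (\<lambda>x. of_real (x ^ i) * (w - complex_of_real x) powr of_real l)"
    by (intro continuous_intros) (use assms in auto)
qed

lemma integrable_powr_kernel:
  fixes w :: complex
  assumes "sets M = sets borel" "integrable M (\<lambda>x. x ^ i)" "Im w \<noteq> 0" "0 \<le> l"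
  shows "integrable M (\<lambda>x. of_real (x ^ i) * (w - of_real x) powr of_real (- l))"
proof (rule Bochner_Integration.integrable_bound)
  show "integrable M (\<lambda>x. \<bar>x\<bar> ^ i * \<bar>Im w\<bar> powr (- l))"
    using integrable_abs[OF assms(2)] by (intro integrable_mult_left) (simp add: power_abs)
  show "(\<lambda>x. of_real (x ^ i) * (w - of_real x) powr of_real (- l)) \<in> borel_measurable M"
    using assms(1) borel_measurable_powr_kernel[OF assms(3), of i "- l"]
    by (auto cong: measurable_cong_sets)
  show "AE x in M. norm (of_real (x ^ i) * (w - of_real x) powr of_real (- l))
          \<le> norm (\<bar>x\<bar> ^ i * \<bar>Im w\<bar> powr (- l))"
    using norm_powr_kernel_le[of "\<bar>Im w\<bar>" w l] assms(3,4) by (simp add: norm_mult)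
qed

text \<open>Differentiation under the integral sign: the difference quotients converge pointwise and
  are dominated by a multiple of |x|^i, which is integrable because all moments are finite.\<close>

lemma has_field_derivative_integral_powr_kernel:
  fixes w :: complex
  assumes M: "sets M = sets borel" "integrable M (\<lambda>x. x ^ i)" and w: "Im w \<noteq> 0" and l: "0 \<le> l"
  shows "((\<lambda>w. \<integral>x. of_real (x ^ i) * (w - of_real x) powr of_real (- l) \<partial>M) has_field_derivative
           of_real (- l) * (\<integral>x. of_real (x ^ i) * (w - of_real x) powr of_real (- l - 1) \<partial>M)) (at w)"
proof -
  define h where "h = (\<lambda>w x. of_real (x ^ i) * (w - complex_of_real x) powr of_real (- l))"
  define h' where "h' = (\<lambda>w x. of_real (- l) *
    (of_real (x ^ i) * (w - complex_of_real x) powr of_real (- l - 1)))"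
  \<comment> \<open>Half the distance from \<open>w\<close> to the real axis, so that the whole ball
    of this radius keeps at least the distance \<open>c\<close> from the axis.\<close>
  define c where "c = \<bar>Im w\<bar> / 2"
  have c: "c > 0" using w by (simp add: c_def)
  have Im_ball: "c \<le> \<bar>Im v\<bar>" if "v \<in> ball w c" for v
    using that abs_Im_le_cmod[of "w - v"] by (simp add: c_def dist_norm)
  have deriv: "((\<lambda>v. h v x) has_field_derivative h' v x) (at v)" if "Im v \<noteq> 0" for v x
    unfolding h_def h'_def by (rule has_field_derivative_powr_kernel) (rule that)
  have int: "integrable M (h v)" if "Im v \<noteq> 0" for v
    unfolding h_def by (rule integrable_powr_kernel) (use M l that in auto)
  \<comment> \<open>The kernel bound for the exponent of the derivative, times the factor
    \<open>l\<close> that differentiation produces.\<close>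
  define b where "b = (\<lambda>x::real. l * (\<bar>x\<bar> ^ i * c powr (- (l + 1))))"
  have norm_h': "norm (h' v x) \<le> b x" if "v \<in> ball w c" for v x
    using norm_powr_kernel_le[OF c Im_ball[OF that], of "l + 1" x i] l
    by (auto simp: h'_def b_def norm_mult abs_mult intro!: mult_left_mono)
  have meas: "h v \<in> borel_measurable M" "h' v \<in> borel_measurable M" if "Im v \<noteq> 0" for v
    using M(1) borel_measurable_powr_kernel[OF that, of i "- l"]
      borel_measurable_powr_kernel[OF that, of i "- l - 1"]
    unfolding h_def h'_def by (auto cong: measurable_cong_sets)
  have "((\<lambda>v. (integral\<^sup>L M (h v) - integral\<^sup>L M (h w)) / (v - w)) \<longlongrightarrow> integral\<^sup>L M (h' w)) (at w)"
    unfolding tendsto_at_iff_sequentially comp_def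
  proof (intro allI impI)
    fix X assume X: "\<forall>n. X n \<in> UNIV - {w}" "X \<longlonglongrightarrow> w"
    have ev: "\<forall>\<^sub>F n in sequentially. X n \<in> ball w c"
      using X(2) c by (auto simp: tendsto_iff dist_commute)
    then obtain N where N: "\<And>n. n \<ge> N \<Longrightarrow> X n \<in> ball w c"
      unfolding eventually_sequentially by blast
    \<comment> \<open>Only a tail of \<open>X\<close> need lie in the ball, whereas the domination
      is required for every index; the shift is undone by \<open>LIMSEQ_offset\<close>.\<close>
    define Y where "Y = (\<lambda>n. X (n + N))"
    have Y: "Y n \<in> ball w c" "Y n \<noteq> w" "Im (Y n) \<noteq> 0" for n
      using N[of "n + N"] X(1) Im_ball[of "Y n"] c by (auto simp: Y_def)
    have Ylim: "Y \<longlonglongrightarrow> w"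
      unfolding Y_def by (rule LIMSEQ_ignore_initial_segment[OF X(2)])
    have "(\<lambda>n. \<integral>x. (h (Y n) x - h w x) / (Y n - w) \<partial>M) \<longlonglongrightarrow> integral\<^sup>L M (h' w)"
    proof (rule integral_dominated_convergence[where w = b])
      show "h' w \<in> borel_measurable M" by (rule meas[OF w])
      show "(\<lambda>x. (h (Y n) x - h w x) / (Y n - w)) \<in> borel_measurable M" for n
        using meas(1)[OF Y(3)] meas(1)[OF w] by measurable
      show "integrable M b"
        unfolding b_def using integrable_abs[OF M(2)]
        by (intro integrable_mult_right integrable_mult_left) (simp add: power_abs)
      show "AE x in M. (\<lambda>n. (h (Y n) x - h w x) / (Y n - w)) \<longlonglongrightarrow> h' w x"
      proof (rule AE_I2)
        fix x
        have "((\<lambda>v. (h v x - h w x) / (v - w)) \<longlongrightarrow> h' w x) (at w)"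
          using deriv[OF w, of x] by (simp add: has_field_derivative_iff)
        moreover have "filterlim Y (at w) sequentially"
          using Ylim Y(2) by (auto simp: filterlim_at)
        ultimately show "(\<lambda>n. (h (Y n) x - h w x) / (Y n - w)) \<longlonglongrightarrow> h' w x"
          by (rule filterlim_compose)
      qed
      show "AE x in M. norm ((h (Y n) x - h w x) / (Y n - w)) \<le> b x" for n
      proof (rule AE_I2)
        fix x
        \<comment> \<open>The mean value inequality on the convex ball turns the bound for
          \<open>h'\<close> into one for the difference quotients.\<close>
        have "norm (h (Y n) x - h w x) \<le> b x * norm (Y n - w)"
        proof (rule field_differentiable_bound[where S = "ball w c" and f' = "\<lambda>v. h' v x"])
          fix v assume v: "v \<in> ball w c"
          then have "Im v \<noteq> 0" using Im_ball[of v] c by auto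
          then show "((\<lambda>v. h v x) has_field_derivative h' v x) (at v within ball w c)"
            by (rule has_field_derivative_at_within[OF deriv])
          show "norm (h' v x) \<le> b x" by (rule norm_h'[OF v])
        qed (use Y(1)[of n] c in auto)
        then show "norm ((h (Y n) x - h w x) / (Y n - w)) \<le> b x"
          using Y(2)[of n] by (simp add: norm_divide field_simps)
      qed
    qed
    also have "(\<lambda>n. \<integral>x. (h (Y n) x - h w x) / (Y n - w) \<partial>M) =
        (\<lambda>n. (integral\<^sup>L M (h (Y n)) - integral\<^sup>L M (h w)) / (Y n - w))"
      using int Y(3) w by (auto simp: integral_diff)
    finally show "(\<lambda>n. (integral\<^sup>L M (h (X n)) - integral\<^sup>L M (h w)) / (X n - w)) \<longlonglongrightarrow>
        integral\<^sup>L M (h' w)"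
      unfolding Y_def by (rule LIMSEQ_offset)
  qed
  then have "((\<lambda>v. integral\<^sup>L M (h v)) has_field_derivative integral\<^sup>L M (h' w)) (at w)"
    by (simp add: has_field_derivative_iff)
  then show ?thesis
    unfolding h_def h'_def by simp
qed

text \<open>Splits one factor w - x off (w - x)^(-l). This relates the integrals with exponent - l
  to those with exponent - l - 1 that arise by differentiation.\<close>

lemma integral_powr_kernel_shift:
  fixes w :: complex
  assumes M: "sets M = sets borel" "\<And>n. integrable M (\<lambda>x. x ^ n)" and w: "Im w \<noteq> 0" and l: "0 \<le> l"
  shows "(\<integral>x. of_real (x ^ i) * (w - of_real x) powr of_real (- l) \<partial>M) =
     w * (\<integral>x. of_real (x ^ i) * (w - of_real x) powr of_real (- l - 1) \<partial>M) -
     (\<integral>x. of_real (x ^ Suc i) * (w - of_real x) powr of_real (- l - 1) \<partial>M)"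
proof -
  have int: "integrable M (\<lambda>x. of_real (x ^ j) * (w - of_real x) powr of_real (- l - 1))" for j
    using integrable_powr_kernel[OF M(1,2) w, of "l + 1" j] l by simp
  have "of_real (x ^ i) * (w - of_real x) powr of_real (- l) =
      w * (of_real (x ^ i) * (w - of_real x) powr of_real (- l - 1)) -
      of_real (x ^ Suc i) * (w - of_real x) powr of_real (- l - 1)" for x
  proof -
    have "w - of_real x \<noteq> 0" using w by auto
    then have "(w - of_real x) powr of_real (- l) =
        (w - of_real x) powr of_real (- l - 1) * (w - of_real x)"
      using powr_add[of "w - of_real x" "of_real (- l - 1)" 1] by (simp add: powr_to_1)
    then have "of_real (x ^ i) * (w - of_real x) powr of_real (- l) =
        of_real (x ^ i) * ((w - of_real x) powr of_real (- l - 1) * (w - of_real x))"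
      by (rule arg_cong)
    then show ?thesis by (simp only: of_real_mult power_Suc algebra_simps)
  qed
  then show ?thesis
    using Bochner_Integration.integral_diff[OF integrable_mult_right[OF int[of i], of w] int[of "Suc i"]]
    by (simp only: integral_mult_right_zero)
qed


section \<open>Moments of the orthogonal polynomials\<close>

text \<open>The monomials 1, x and x^2 are combinations of \<open>P 0\<close>, \<open>P 1\<close>
  and \<open>P 2\<close>, so orthogonality leaves only finitely many nonzero moments. The values
  \<alpha>_0 = 0 and \<omega>_1 = 1 are derived here from mean 0 and variance 1.\<close>

lemma jacobi_szego_moments:
  assumes M: "standard_measure M" and J: "jacobi_szego M P \<alpha> \<omega>"
  shows "(\<integral>x. poly (P n) x \<partial>M) = (if n = 0 then 1 else 0)"
    and "(\<integral>x. x * poly (P n) x \<partial>M) = (if n = 1 then 1 else 0)"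
    and "(\<integral>x. x ^ 2 * poly (P n) x \<partial>M) =
           (if n = 0 then 1 else if n = 1 then \<alpha> 1 else if n = 2 then \<omega> 2 else 0)"
proof -
  interpret real_distribution M
    using M by (simp add: standard_measure_def)
  define I where "I = (\<lambda>p::real poly. \<integral>x. poly p x \<partial>M)"
  define X where "X = [:0, 1::real:]"
  have int: "integrable M (\<lambda>x. poly p x)" for p
    using M by (auto simp: poly_altdef standard_measure_def)
  have I_add: "I (p + q) = I p + I q" for p q
    using int[of p] int[of q] by (simp add: I_def poly_add[abs_def])
  have I_smult: "I (smult c p) = c * I p" for c p
    by (simp add: I_def poly_smult[abs_def])
  have ortho: "I (P n * P m) = 0" if "m \<noteq> n" for m n
    using J that by (auto simp: jacobi_szego_def I_def poly_mult[abs_def])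
  have rec: "X * P n = P (n + 1) + smult (\<alpha> n) (P n) +
            (if n = 0 then 0 else smult (\<omega> n) (P (n - 1)))" for n
    using J unfolding jacobi_szego_def X_def by blast
  have P0: "P 0 = 1"
  proof -
    have P0: "degree (P 0) = 0 \<and> lead_coeff (P 0) = 1"
      using J unfolding jacobi_szego_def by blast
    then obtain c where "P 0 = [:c:]" by (auto elim: degree_eq_zeroE)
    with P0 show ?thesis by (simp add: one_pCons)
  qed
  have I_eq: "I p = (\<integral>x. g x \<partial>M)" if "\<And>x. poly p x = g x" for p g
    unfolding I_def that ..
  have I_const: "I [:c:] = c" for c
    using I_eq[of "[:c:]" "\<lambda>_. c"] prob_space by simp
  then have I1: "I 1 = 1" by (simp add: one_pCons)
  have mean: "I X = 0"
    using M I_eq[of X "\<lambda>x. x"] by (simp add: X_def standard_measure_def)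
  have var: "I (X * X) = 1"
  proof -
    have "expectation (\<lambda>x. x) = 0" "variance (\<lambda>x. x) = 1"
      using M unfolding standard_measure_def by blast+
    then have "expectation (\<lambda>x. x ^ 2) = 1"
      by (simp only: diff_zero)
    moreover have "I (X * X) = expectation (\<lambda>x. x ^ 2)"
      by (rule I_eq) (simp add: X_def power2_eq_square)
    ultimately show ?thesis by simp
  qed
  have X: "X = P 1 + smult (\<alpha> 0) 1"
    using rec[of 0] P0 by simp
  \<comment> \<open>Integrate the formula for \<open>X\<close>: its mean is 0, and
    \<open>P 1\<close> is orthogonal to \<open>P 0 = 1\<close>.\<close>
  have "\<alpha> 0 = 0"
    using ortho[of 0 1] mean I1 P0 X I_add[of "P 1" "smult (\<alpha> 0) 1"] by (simp add: I_const)
  then have P1: "P 1 = X" using X by simp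
  have XX: "X * X = P 2 + smult (\<alpha> 1) (P 1) + smult (\<omega> 1) 1"
    using rec[of 1] P0 P1 by (simp add: numeral_2_eq_2)
  \<comment> \<open>Integrate \<open>XX\<close>: the second moment is 1, and \<open>P 1\<close>,
    \<open>P 2\<close> are orthogonal to 1.\<close>
  have "\<omega> 1 = 1"
    using ortho[of 0 1] ortho[of 0 2] var XX P0 by (simp add: I_smult I_add I_const)
  with XX have XX: "X * X = P 2 + smult (\<alpha> 1) (P 1) + 1" by simp
  \<comment> \<open>Expanding x^2 \<open>P 2\<close> in two ways, through x^2 and through the
    recurrence for x \<open>P 2\<close>, and integrating gives the squared norm of
    \<open>P 2\<close> as \<omega>_2 times that of \<open>P 1\<close>.\<close>
  have "P 2 * P 2 + smult (\<alpha> 1) (P 2 * P 1) + P 2 = P 2 * (X * X)"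
    unfolding XX by (simp add: algebra_simps)
  also have "\<dots> = X * P 2 * P 1"
    unfolding P1 by (simp only: mult_ac)
  also have "\<dots> = P 3 * P 1 + smult (\<alpha> 2) (P 2 * P 1) + smult (\<omega> 2) (P 1 * P 1)"
    using rec[of 2] by (simp add: algebra_simps eval_nat_numeral)
  finally have "I (P 2 * P 2 + smult (\<alpha> 1) (P 2 * P 1) + P 2) =
      I (P 3 * P 1 + smult (\<alpha> 2) (P 2 * P 1) + smult (\<omega> 2) (P 1 * P 1))"
    by (rule arg_cong)
  then have "I (P 2 * P 2) + \<alpha> 1 * I (P 2 * P 1) + I (P 2 * P 0) =
      I (P 3 * P 1) + \<alpha> 2 * I (P 2 * P 1) + \<omega> 2 * I (P 1 * P 1)"
    using P0 by (simp add: I_add I_smult)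
  then have P22: "I (P 2 * P 2) = \<omega> 2"
    using ortho[of 1 2] ortho[of 0 2] ortho[of 1 3] var P1 by simp
  show "(\<integral>x. poly (P n) x \<partial>M) = (if n = 0 then 1 else 0)"
    using ortho[of 0 n] P0 I_eq[of "P n" "poly (P n)"] prob_space by auto
  show "(\<integral>x. x * poly (P n) x \<partial>M) = (if n = 1 then 1 else 0)"
    using ortho[of n 1] var P1 I_eq[of "X * P n" "\<lambda>x. x * poly (P n) x"] by (auto simp: X_def)
  have "(\<integral>x. x ^ 2 * poly (P n) x \<partial>M) = I (X * X * P n)"
    by (rule I_eq[symmetric]) (simp add: X_def power2_eq_square mult.assoc)
  also have "\<dots> = I (P 2 * P n) + \<alpha> 1 * I (P 1 * P n) + I (P 0 * P n)"
    by (simp add: XX P0 distrib_right I_add I_smult)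
  finally show "(\<integral>x. x ^ 2 * poly (P n) x \<partial>M) =
           (if n = 0 then 1 else if n = 1 then \<alpha> 1 else if n = 2 then \<omega> 2 else 0)"
    using ortho[of n 0] ortho[of n 1] ortho[of n 2] P22 var I1 P0 P1 by auto
qed

section \<open>From the generating function to the Riccati equation\<close>

text \<open>On the support, x^i times the series is the kernel at w = \<open>f z\<close> divided by
  \<open>u z\<close>. Integrating termwise leaves the moments with n at most 2; the coefficients
  \<open>l\<close> and \<open>l * (l + 1) / 2\<close> are (l)_n / n! for n = 1, 2.\<close>

lemma moments_generating_function:
  fixes l :: real
  assumes M: "standard_measure M" and J: "jacobi_szego M P \<alpha> \<omega>"
    and gf: "ultraspherical_gf l M P S u f" and ic: "interchange_condition l M P S" and z: "z \<in> S"
  defines "G \<equiv> \<lambda>i w. \<integral>x. of_real (x ^ i) * (w - of_real x) powr of_real (- l) \<partial>M"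
  shows "G 0 (f z) = u z"
    and "G 1 (f z) = of_real l * z * u z"
    and "G 2 (f z) = (1 + of_real (l * \<alpha> 1) * z + of_real (l * (l + 1) / 2 * \<omega> 2) * z ^ 2) * u z"
proof -
  have sets: "sets M = sets borel"
    using M by (simp add: standard_measure_def real_distribution_def real_distribution_axioms_def)
  have Im: "Im (f z) \<noteq> 0" and u: "u z \<noteq> 0"
    using gf z by (auto simp: ultraspherical_gf_def)
  define m where "m = (\<lambda>i n. \<integral>x. x ^ i * poly (P n) x \<partial>M)"
  have key: "G i (f z) = u z * (\<Sum>n<3. of_real (pochhammer l n / fact n * m i n) * z ^ n)"
    if i: "i \<in> {0, 1, 2}" for i :: nat
  proof -
    define s where
      "s = (\<lambda>x. \<Sum>n. of_real (pochhammer l n / fact n * x ^ i * poly (P n) x) * z ^ n)"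
    have supp: "s x = of_real (x ^ i) * (f z - of_real x) powr of_real (- l) / u z"
      if "x \<in> measure_supp M" for x
    proof -
      have "(\<lambda>n. of_real (pochhammer l n / fact n * poly (P n) x) * z ^ n) sums
          (1 / (u z * (f z - of_real x) powr of_real l))"
        using gf z that by (simp add: ultraspherical_gf_def)
      from sums_mult[OF this, of "of_real (x ^ i)"]
      have "s x = of_real (x ^ i) * (1 / (u z * (f z - of_real x) powr of_real l))"
        unfolding s_def by (intro sums_unique[symmetric]) (simp add: mult_ac)
      then show ?thesis
        by (simp add: powr_minus divide_inverse mult_ac)
    qed
    have "(\<lambda>n. of_real (pochhammer l n / fact n * m i n) * z ^ n) sums integral\<^sup>L M s"
      using ic i z unfolding interchange_condition_def s_def m_def by blast
    moreover have "(\<lambda>n. of_real (pochhammer l n / fact n * m i n) * z ^ n) sums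
        (\<Sum>n<3. of_real (pochhammer l n / fact n * m i n) * z ^ n)"
    proof (rule sums_finite)
      fix n :: nat assume "n \<notin> {..<3}"
      then have "m i n = 0"
        using i jacobi_szego_moments[OF M J, of n] by (auto simp: m_def)
      then show "of_real (pochhammer l n / fact n * m i n) * z ^ n = 0" by simp
    qed simp
    ultimately have "integral\<^sup>L M s = (\<Sum>n<3. of_real (pochhammer l n / fact n * m i n) * z ^ n)"
      by (rule sums_unique2)
    moreover have "integral\<^sup>L M s = G i (f z) / u z"
    proof -
      \<comment> \<open>Off the support nothing identifies \<open>s\<close> with the kernel, so its
        measurability is taken from the integrability in the interchange condition.\<close>
      have s_meas: "s \<in> borel_measurable M"
        using ic i z unfolding interchange_condition_def s_def by (auto dest: borel_measurable_integrable)
      have "integral\<^sup>L M s = (\<integral>x. of_real (x ^ i) * (f z - of_real x) powr of_real (- l) / u z \<partial>M)"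
      proof (rule integral_cong_AE)
        show "(\<lambda>x. of_real (x ^ i) * (f z - of_real x) powr of_real (- l) / u z) \<in> borel_measurable M"
          using borel_measurable_powr_kernel[OF Im, of i "- l"]
          by (intro borel_measurable_divide) (auto cong: measurable_cong_sets simp: sets)
        show "AE x in M. s x = of_real (x ^ i) * (f z - of_real x) powr of_real (- l) / u z"
          using AE_measure_supp[OF sets] by eventually_elim (rule supp)
      qed (rule s_meas)
      then show ?thesis by (simp add: G_def)
    qed
    ultimately show ?thesis using u by (simp add: field_simps)
  qed
  show "G 0 (f z) = u z" "G 1 (f z) = of_real l * z * u z"
    "G 2 (f z) = (1 + of_real (l * \<alpha> 1) * z + of_real (l * (l + 1) / 2 * \<omega> 2) * z ^ 2) * u z"
    using key[of 0] key[of 1] key[of 2] jacobi_szego_moments[OF M J]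
    by (auto simp: m_def eval_nat_numeral pochhammer_rec algebra_simps)
qed

text \<open>The shift relations for i = 0 and i = 1, multiplied by - l f', involve only products
  whose values are known from differentiating along \<open>f\<close>. They become two linear
  equations for u'/u, and its elimination leaves an equation in \<open>f\<close> and
  \<open>f'\<close> alone.\<close>

lemma ultraspherical_riccati:
  fixes l :: real
  assumes l: "l > 0" and M: "standard_measure M" and J: "jacobi_szego M P \<alpha> \<omega>"
    and gf: "ultraspherical_gf l M P S u f" and ic: "interchange_condition l M P S" and z: "z \<in> S"
    and Df: "(f has_field_derivative f') (at z)"
  defines "q \<equiv> 1 + of_real (l * \<alpha> 1) * z + of_real (l * (l + 1) / 2 * \<omega> 2) * z ^ 2"
    and "Q \<equiv> of_real ((l + 1) * \<omega> 2) * z + of_real (\<alpha> 1)"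
  shows "f' * (q - of_real l ^ 2 * z ^ 2) = q + Q * f z - of_real l * z * Q - f z ^ 2"
proof -
  have sets: "sets M = sets borel"
    using M by (simp add: standard_measure_def real_distribution_def real_distribution_axioms_def)
  have moments: "integrable M (\<lambda>x. x ^ n)" for n
    using M by (simp add: standard_measure_def)
  have S: "open S" and Im: "Im (f z) \<noteq> 0" and u: "u z \<noteq> 0"
    using gf z by (auto simp: ultraspherical_gf_def)
  define L where "L = complex_of_real l"
  have L: "L \<noteq> 0" using l by (simp add: L_def)
  define A where "A = (\<lambda>i. \<integral>x. of_real (x ^ i) * (f z - of_real x) powr of_real (- l - 1) \<partial>M)"
  obtain u' where Du: "(u has_field_derivative u') (at z)"
    using gf z unfolding ultraspherical_gf_def
    by (meson analytic_on_imp_differentiable_at field_differentiable_def)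
  have DG: "((\<lambda>y. \<integral>x. of_real (x ^ i) * (f y - of_real x) powr of_real (- l) \<partial>M)
      has_field_derivative - L * A i * f') (at z)" for i
    using DERIV_chain2[OF has_field_derivative_integral_powr_kernel[OF sets moments Im, of l i] Df] l
    by (simp add: A_def L_def)
  \<comment> \<open>The closed form \<open>g\<close> holds on all of the open set \<open>S\<close>,
    so both sides have the same derivative at \<open>z\<close>.\<close>
  have DG': "- L * A i * f' = D"
    if eq: "\<And>y. y \<in> S \<Longrightarrow> (\<integral>x. of_real (x ^ i) * (f y - of_real x) powr of_real (- l) \<partial>M) = g y"
      and Dg: "(g has_field_derivative D) (at z)" for i g D
    using DERIV_unique[OF has_field_derivative_transform_within_open[OF DG S z eq] Dg] by simp
  note G = moments_generating_function[OF M J gf ic]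
  have D0: "- L * A 0 * f' = u'"
    by (rule DG'[OF G(1) Du])
  have D1: "- L * A 1 * f' = L * u z + L * z * u'"
    by (rule DG'[OF G(2)]) (auto intro!: derivative_eq_intros Du simp: L_def)
  \<comment> \<open>Here \<open>Q\<close> enters: the derivative of \<open>q\<close> with respect to
    z is \<open>L * Q\<close>.\<close>
  have D2: "- L * A 2 * f' = L * Q * u z + q * u'"
    by (rule DG'[OF G(3)])
      (auto intro!: derivative_eq_intros Du simp: L_def q_def Q_def field_simps)
  have S0: "u z = f z * A 0 - A 1" and S1: "L * z * u z = f z * A 1 - A 2"
    using integral_powr_kernel_shift[OF sets moments Im, of l 0]
      integral_powr_kernel_shift[OF sets moments Im, of l 1] G(1,2)[OF z] l
    by (simp_all add: A_def L_def eval_nat_numeral)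
  have "- L * f' * u z = f z * (- L * A 0 * f') - (- L * A 1 * f')"
    unfolding S0 by (simp add: algebra_simps)
  then have E1: "u' * (f z - L * z) = L * u z * (1 - f')"
    unfolding D0 D1 by (simp add: algebra_simps)
  have "- L * f' * (L * z * u z) = f z * (- L * A 1 * f') - (- L * A 2 * f')"
    unfolding S1 by (simp add: algebra_simps)
  then have E2: "u' * (L * z * f z - q) = L * u z * (Q - f z - L * z * f')"
    unfolding D1 D2 by (simp add: algebra_simps)
  \<comment> \<open>Cross-multiplying \<open>E1\<close> and \<open>E2\<close> avoids dividing by
    \<open>f z - L * z\<close>, which might vanish; only the nonzero factor \<open>L * u z\<close>
    is cancelled. The products L z f f' on the two sides then cancel, so the result is linear in
    \<open>f'\<close>.\<close>
  have "L * u z * ((1 - f') * (L * z * f z - q)) = u' * (f z - L * z) * (L * z * f z - q)"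
    unfolding E1 by simp
  also have "\<dots> = u' * (L * z * f z - q) * (f z - L * z)" by simp
  also have "\<dots> = L * u z * ((Q - f z - L * z * f') * (f z - L * z))"
    unfolding E2 by simp
  finally have "(1 - f') * (L * z * f z - q) = (Q - f z - L * z * f') * (f z - L * z)"
    using L u by simp
  then show ?thesis
    unfolding L_def[symmetric] by (simp add: algebra_simps power2_eq_square)
qed

section \<open>Polynomial identity and degree bound\<close>

text \<open>Since z E' - E has degree at most deg E, a degree above 2 would force 2 deg E to be at
  most deg E + 2.\<close>

lemma degree_le_2_of_riccati:
  fixes E q r R :: "'a :: field_char_0 poly"
  assumes "E * E + ([:0, 1:] * pderiv E - E + r) * q = R"
    and "degree q \<le> 2" "degree r \<le> 2" "degree R \<le> 4"
  shows "degree E \<le> 2"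
proof (rule ccontr)
  assume d: "\<not> degree E \<le> 2"
  have "degree ([:0, 1:] * pderiv E) \<le> degree E"
    using degree_mult_le[of "[:0, 1:]" "pderiv E"] degree_pderiv[of E] d by simp
  then have "degree ([:0, 1:] * pderiv E - E + r) \<le> degree E"
    using assms(3) d by (intro degree_add_le degree_diff_le) auto
  then have "degree (([:0, 1:] * pderiv E - E + r) * q) \<le> degree E + 2"
    using assms(2) degree_mult_le[of "[:0, 1:] * pderiv E - E + r" q] by linarith
  moreover have "E * E = R - ([:0, 1:] * pderiv E - E + r) * q"
    using assms(1) by (simp add: algebra_simps)
  ultimately have "degree (E * E) \<le> degree E + 2"
    using assms(4) d by (simp only:) (intro degree_diff_le; simp)
  moreover have "degree (E * E) = degree E + degree E"
    using d by (intro degree_mult_eq) auto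
  ultimately show False using d by simp
qed

text \<open>A nonempty open subset of the plane is infinite, hence too large to consist of roots of
  a nonzero polynomial.\<close>

lemma poly_eqI_open:
  fixes p q :: "complex poly"
  assumes "open S" "S \<noteq> {}" "\<And>z. z \<in> S \<Longrightarrow> poly p z = poly q z"
  shows "p = q"
proof (rule ccontr)
  assume "p \<noteq> q"
  then have "finite {z. poly (p - q) z = 0}" by (intro poly_roots_finite) simp
  moreover have "S \<subseteq> {z. poly (p - q) z = 0}" using assms(3) by auto
  ultimately have "finite S" by (rule rev_finite_subset)
  with assms(1,2) show False by (simp add: finite_imp_not_open)
qed

theorem mainTheorem2:
  fixes l :: real and M :: "real measure" and P :: "nat \<Rightarrow> real poly"
    and \<alpha> \<omega> :: "nat \<Rightarrow> real" and S :: "complex set" and u f Q\<^sub>1 :: "complex \<Rightarrow> complex"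
    and E :: "complex poly"
  assumes "l > 0"
    and "standard_measure M"
    and "jacobi_szego M P \<alpha> \<omega>"
    and "ultraspherical_gf l M P S u f"
    and "interchange_condition l M P S"
    and "\<And>z. Q\<^sub>1 z = of_real ((l + 1) * \<omega> 2) * z + of_real (\<alpha> 1)"
    and "\<And>z. z \<in> S \<Longrightarrow> f z - Q\<^sub>1 z / 2 = poly E z / z"
  shows "degree E \<le> 2"
proof -
  have S: "open S" "S \<noteq> {}" "S \<inter> \<real>\<^sub>\<le>\<^sub>0 = {}"
    using assms(4) by (auto simp: ultraspherical_gf_def)
  define L a w where "L = complex_of_real l" and "a = complex_of_real (\<alpha> 1)"
    and "w = complex_of_real (\<omega> 2)"
  \<comment> \<open>In terms of the Riccati equation, \<open>q\<close> is q_2 - l^2 z^2,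
    \<open>r\<close> is z^2 Q_1'/2, and \<open>R\<close> is z^2 (q_2 - l z Q_1 + Q_1^2/4), in which
    the linear terms of q_2 and l z Q_1 cancel.\<close>
  define q where "q = [:1, L * a, L * (L + 1) / 2 * w - L ^ 2:]"
  define r where "r = [:0, 0, (L + 1) * w / 2:]"
  define R where "R = [:0, 0, 1 + a ^ 2 / 4, a * (L + 1) * w / 2,
      (L + 1) ^ 2 * w ^ 2 / 4 - L * (L + 1) * w / 2:]"
  have "E * E + ([:0, 1:] * pderiv E - E + r) * q = R"
  proof (rule poly_eqI_open[OF S(1,2)])
    fix z assume z: "z \<in> S"
    have z0: "z \<noteq> 0" using z S(3) by auto
    define e e' where "e = poly E z" and "e' = poly (pderiv E) z"
    have f: "f y = ((L + 1) * w * y + a) / 2 + poly E y / y" if "y \<in> S" for y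
      using assms(7)[OF that] assms(6)[of y] by (simp add: L_def a_def w_def algebra_simps)
    have "((\<lambda>y. ((L + 1) * w * y + a) / 2 + poly E y / y) has_field_derivative
        ((L + 1) * w / 2 + e' / z - e / z ^ 2)) (at z)"
      using z0 unfolding e_def e'_def
      by (auto intro!: derivative_eq_intros simp: field_simps power2_eq_square)
    then have Df: "(f has_field_derivative ((L + 1) * w / 2 + e' / z - e / z ^ 2)) (at z)"
      by (rule has_field_derivative_transform_within_open[OF _ S(1) z]) (simp add: f)
    define Q where "Q = (L + 1) * w * z + a"
    define p where "p = 1 + L * a * z + L * (L + 1) / 2 * w * z ^ 2"
    have "((L + 1) * w / 2 + e' / z - e / z ^ 2) * (p - L ^ 2 * z ^ 2) =
        p + Q * (Q / 2 + e / z) - L * z * Q - (Q / 2 + e / z) ^ 2"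
      using ultraspherical_riccati[OF assms(1-5) z Df] f[OF z]
      by (simp add: L_def a_def w_def e_def p_def Q_def)
    then have "z ^ 2 * (((L + 1) * w / 2 + e' / z - e / z ^ 2) * (p - L ^ 2 * z ^ 2)) =
        z ^ 2 * (p + Q * (Q / 2 + e / z) - L * z * Q - (Q / 2 + e / z) ^ 2)"
      by simp
    moreover have "z ^ 2 * ((L + 1) * w / 2 + e' / z - e / z ^ 2) = (L + 1) * w / 2 * z ^ 2 + z * e' - e"
      using z0 by (simp add: field_simps power2_eq_square)
    \<comment> \<open>Completing the square: Q f - f^2 = Q^2/4 - (f - Q/2)^2. Subtracting Q/2 from
      \<open>f\<close> thus removes the mixed term, and \<open>e\<close> enters the right-hand side
      only through its square.\<close>
    moreover have "z ^ 2 * (p + Q * (Q / 2 + e / z) - L * z * Q - (Q / 2 + e / z) ^ 2) =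
        z ^ 2 * (p - L * z * Q + Q ^ 2 / 4) - e ^ 2"
      using z0 by (simp add: field_simps power2_eq_square)
    ultimately have "((L + 1) * w / 2 * z ^ 2 + z * e' - e) * (p - L ^ 2 * z ^ 2) =
        z ^ 2 * (p - L * z * Q + Q ^ 2 / 4) - e ^ 2"
      by (simp only: mult.assoc[symmetric])
    moreover have "poly q z = p - L ^ 2 * z ^ 2"
      by (simp add: q_def p_def power2_eq_square algebra_simps)
    moreover have "poly r z = (L + 1) * w / 2 * z ^ 2"
      by (simp add: r_def power2_eq_square)
    moreover have "poly R z = z ^ 2 * (p - L * z * Q + Q ^ 2 / 4)"
      by (simp add: R_def p_def Q_def power2_eq_square field_simps)
    moreover have "poly (E * E + ([:0, 1:] * pderiv E - E + r) * q) z =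
        e ^ 2 + (poly r z + z * e' - e) * poly q z"
      by (simp add: e_def e'_def power2_eq_square algebra_simps)
    ultimately show "poly (E * E + ([:0, 1:] * pderiv E - E + r) * q) z = poly R z"
      by (simp only: diff_add_cancel add_diff_eq add_diff_cancel_left')
  qed
  then show ?thesis
    by (rule degree_le_2_of_riccati) (simp_all add: q_def r_def R_def degree_pCons_eq_if)
qed

end
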